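(* Let $k\geq 2$ and $l$ be positive integers and let $f(l)$ be any function with $f(l)=o(l)$ as $l\to\infty$. Let $X=(X_{i,j})$ be a uniformly chosen $(k,l)$-intersection matrix. Then, with $k$ fixed, asymptotically almost surely (i.e. with probability tending to $1$) as $l\to\infty$, $$\min_{1\le i,j\le k}|X_{i,j}-l/k|>f(l).$$
   Context: A $(k,l)$-intersection matrix is a $k\times k$ matrix of non-negative integers all of whose row sums and column sums are equal to $l$. Uniformly chosen means chosen uniformly from the finite set of all $(k,l)$-intersection matrices. *)

theory Defs
  imports "HOL-Probability.Probability" "HOL-Library.Landau_Symbols" "Jordan_Normal_Form.Matrix"
begin

text \<open>Rows and columns are indexed by \<open>0, \<dots>, k - 1\<close>, following the convention of
  \<^typ>\<open>'a mat\<close>.\<close>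

definition intersection_matrices :: "nat \<Rightarrow> nat \<Rightarrow> nat mat set" where
  "intersection_matrices k l =
     {A \<in> carrier_mat k k.
        (\<forall>i<k. (\<Sum>j<k. A $$ (i, j)) = l) \<and> (\<forall>j<k. (\<Sum>i<k. A $$ (i, j)) = l)}"

text \<open>\<^const>\<open>pmf_of_set\<close> is the uniform distribution only on a finite nonempty set; the next
  two lemmas show that this is the case here.\<close>

lemma finite_intersection_matrices: "finite (intersection_matrices k l)"
proof -
  have entry: "A $$ (i, j) \<le> l" if "A \<in> intersection_matrices k l" "i < k" "j < k" for A i j
    using that member_le_sum[of j "{..<k}" "\<lambda>j. A $$ (i, j)"]
    by (auto simp: intersection_matrices_def)
  have "intersection_matrices k l \<subseteq>
      (\<lambda>g. mat k k g) ` (({..<k} \<times> {..<k}) \<rightarrow>\<^sub>E {..l})"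
  proof
    fix A assume A: "A \<in> intersection_matrices k l"
    let ?g = "restrict (\<lambda>p. A $$ p) ({..<k} \<times> {..<k})"
    have "A = mat k k ?g"
      using A by (intro eq_matI) (auto simp: intersection_matrices_def)
    moreover have "?g \<in> ({..<k} \<times> {..<k}) \<rightarrow>\<^sub>E {..l}"
      using entry[OF A] by auto
    ultimately show "A \<in> (\<lambda>g. mat k k g) ` (({..<k} \<times> {..<k}) \<rightarrow>\<^sub>E {..l})"
      by blast
  qed
  then show ?thesis
    by (rule finite_subset) (auto intro!: finite_imageI finite_PiE)
qed

lemma intersection_matrices_nonempty: "intersection_matrices k l \<noteq> {}"
proof -
  have "mat k k (\<lambda>(i, j). if i = j then l else 0) \<in> intersection_matrices k l"
    by (auto simp: intersection_matrices_def)
  then show ?thesis by blast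
qed

definition random_intersection_matrix :: "nat \<Rightarrow> nat \<Rightarrow> nat mat pmf" where
  "random_intersection_matrix k l = pmf_of_set (intersection_matrices k l)"

definition min_deviation :: "nat \<Rightarrow> nat \<Rightarrow> nat mat \<Rightarrow> real" where
  "min_deviation k l X =
     Min ((\<lambda>(i, j). \<bar>real (X $$ (i, j)) - real l / real k\<bar>) ` ({..<k} \<times> {..<k}))"

end

theory Submission
  imports Defs
begin

text \<open>
  Write \<open>k = n + 1\<close>. An intersection matrix is determined by any \<open>n \<times> n\<close> block, the line sums
  filling in the remaining row and column. Hence there are of the order of \<open>l\<^bsup>n\<^sup>2\<^esup>\<close> matrices, while
  prescribing a single entry removes one of the \<open>n\<^sup>2\<close> degrees of freedom and leaves only
  \<open>O(l\<^bsup>n\<^sup>2 - 1\<^esup>)\<close>. So a given entry takes a given value with probability \<open>O(1 / l)\<close>, uniformly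
  in the value. The values within \<open>f(l)\<close> of \<open>l / k\<close> number at most \<open>2 \<bar>f(l)\<bar> + 1\<close>, and a
  union bound over these values and over the \<open>k\<^sup>2\<close> positions gives failure probability
  \<open>O((\<bar>f(l)\<bar> + 1) / l)\<close>, which tends to zero.

  The upper count is \<open>card_fixed_entry_le\<close>, the lower count \<open>card_intersection_matrices_ge\<close>;
  their quotient is \<open>fixed_entry_ratio\<close>. Only the order of magnitude of the lower count
  matters, so it suffices to let all entries of the block range freely over an interval just
  below \<open>l / n\<close>, of length proportional to \<open>l\<close>.
\<close>

section \<open>Determination by a block and the upper count\<close>

lemma intersection_matrix_row:
  "A \<in> intersection_matrices k l \<Longrightarrow> i < k \<Longrightarrow> (\<Sum>j<k. A $$ (i, j)) = l"
  by (auto simp: intersection_matrices_def)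

lemma intersection_matrix_col:
  "A \<in> intersection_matrices k l \<Longrightarrow> j < k \<Longrightarrow> (\<Sum>i<k. A $$ (i, j)) = l"
  by (auto simp: intersection_matrices_def)

lemma intersection_matrix_entry_le:
  assumes "A \<in> intersection_matrices k l" "i < k" "j < k"
  shows "A $$ (i, j) \<le> l"
  using intersection_matrix_row[OF assms(1,2)] member_le_sum[of j "{..<k}" "\<lambda>j. A $$ (i, j)"] assms(3)
  by auto

text \<open>Row sums recover the missing column \<open>c\<close> outside row \<open>r\<close>; then column sums recover
  row \<open>r\<close>.\<close>

lemma intersection_matrix_eqI:
  assumes A: "A \<in> intersection_matrices k l" and B: "B \<in> intersection_matrices k l"
    and r: "r < k" and c: "c < k"
    and eq: "\<And>i j. i < k \<Longrightarrow> j < k \<Longrightarrow> i \<noteq> r \<Longrightarrow> j \<noteq> c \<Longrightarrow> A $$ (i, j) = B $$ (i, j)"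
  shows "A = B"
proof -
  have rows: "A $$ (i, j) = B $$ (i, j)" if ij: "i < k" "j < k" "i \<noteq> r" for i j
  proof (cases "j = c")
    case True
    have "A $$ (i, c) + (\<Sum>j\<in>{..<k} - {c}. A $$ (i, j))
        = B $$ (i, c) + (\<Sum>j\<in>{..<k} - {c}. B $$ (i, j))"
      using intersection_matrix_row[OF A ij(1)] intersection_matrix_row[OF B ij(1)] c
      by (simp add: sum.remove[of "{..<k}" c])
    moreover have "(\<Sum>j\<in>{..<k} - {c}. A $$ (i, j)) = (\<Sum>j\<in>{..<k} - {c}. B $$ (i, j))"
      using ij eq by (intro sum.cong) auto
    ultimately show ?thesis using True by simp
  qed (use eq ij in auto)
  have entries: "A $$ (i, j) = B $$ (i, j)" if ij: "i < k" "j < k" for i j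
  proof (cases "i = r")
    case True
    have "A $$ (r, j) + (\<Sum>i\<in>{..<k} - {r}. A $$ (i, j))
        = B $$ (r, j) + (\<Sum>i\<in>{..<k} - {r}. B $$ (i, j))"
      using intersection_matrix_col[OF A ij(2)] intersection_matrix_col[OF B ij(2)] r
      by (simp add: sum.remove[of "{..<k}" r])
    moreover have "(\<Sum>i\<in>{..<k} - {r}. A $$ (i, j)) = (\<Sum>i\<in>{..<k} - {r}. B $$ (i, j))"
      using ij rows by (intro sum.cong) auto
    ultimately show ?thesis using True by simp
  qed (use rows ij in auto)
  show ?thesis
    using A B entries by (intro eq_matI) (auto simp: intersection_matrices_def)
qed

text \<open>Choose the determining \<open>n \<times> n\<close> block so that it contains the prescribed entry; the other
  \<open>n\<^sup>2 - 1\<close> block entries have at most \<open>l + 1\<close> values each.\<close>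

lemma card_fixed_entry_le:
  assumes n: "n \<ge> 1" and i: "i < Suc n" and j: "j < Suc n"
  shows "card {A \<in> intersection_matrices (Suc n) l. A $$ (i, j) = a} \<le> (l + 1) ^ (n\<^sup>2 - 1)"
proof -
  let ?N = "{A \<in> intersection_matrices (Suc n) l. A $$ (i, j) = a}"
  define r where "r = (if i = 0 then 1 else 0 :: nat)"
  define c where "c = (if j = 0 then 1 else 0 :: nat)"
  have r: "r < Suc n" "i \<noteq> r" and c: "c < Suc n" "j \<noteq> c"
    using n by (auto simp: r_def c_def)
  define D where "D = ({..<Suc n} - {r}) \<times> ({..<Suc n} - {c}) - {(i, j)}"
  have finD: "finite D" by (simp add: D_def)
  have cardD: "card D = n\<^sup>2 - 1"
    using r c i j by (simp add: D_def card_Diff_singleton card_cartesian_product power2_eq_square)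
  have "inj_on (\<lambda>A. restrict (($$) A) D) ?N"
  proof (rule inj_onI)
    fix A B assume A: "A \<in> ?N" and B: "B \<in> ?N"
      and eq: "restrict (($$) A) D = restrict (($$) B) D"
    show "A = B"
    proof (rule intersection_matrix_eqI[of A _ l B, OF _ _ r(1) c(1)])
      fix i' j' assume ij: "i' < Suc n" "j' < Suc n" "i' \<noteq> r" "j' \<noteq> c"
      show "A $$ (i', j') = B $$ (i', j')"
      proof (cases "(i', j') = (i, j)")
        case False
        then have "(i', j') \<in> D" using ij by (auto simp: D_def)
        then show ?thesis using fun_cong[OF eq, of "(i', j')"] by simp
      qed (use A B in auto)
    qed (use A B in auto)
  qed
  moreover have "(\<lambda>A. restrict (($$) A) D) ` ?N \<subseteq> D \<rightarrow>\<^sub>E {..l}"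
  proof (clarsimp simp only: image_subset_iff restrict_PiE_iff mem_Collect_eq atMost_iff)
    fix A i' j' assume "A \<in> intersection_matrices (Suc n) l" "(i', j') \<in> D"
    then show "A $$ (i', j') \<le> l"
      by (intro intersection_matrix_entry_le) (auto simp: D_def)
  qed
  ultimately have "card ?N \<le> card (D \<rightarrow>\<^sub>E {..l})"
    using finD by (intro card_inj_on_le) (auto intro: finite_PiE)
  also have "\<dots> = (l + 1) ^ (n\<^sup>2 - 1)"
    using finD by (simp add: card_PiE cardD)
  finally show ?thesis .
qed

section \<open>Completing a block and the lower count\<close>

text \<open>Values \<open>x\<close> that can be put freely into the \<open>n \<times> n\<close> block: the first inequality keeps the
  completing entries of the last row and column nonnegative, the second does the same for the
  corner, whose value is the sum of the block minus \<open>(n - 1) l\<close>. Over the reals the two say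
  \<open>l / n - l / n\<^sup>2 \<le> x \<le> l / n\<close>, an interval of length \<open>l / n\<^sup>2\<close>; the integer interval
  below has exactly \<open>l div n\<^sup>2\<close> elements.\<close>

lemma block_value_bounds:
  fixes n l x :: nat
  assumes n: "n \<ge> 1" and x: "x \<in> {l div n - l div n\<^sup>2 <.. l div n}"
  shows "n * x \<le> l" and "(n - 1) * l \<le> n\<^sup>2 * x"
proof -
  let ?q = "l div n\<^sup>2" and ?m = "l div n"
  have m: "n * ?m \<le> l" and l: "l \<le> n * ?m + n" and q: "n\<^sup>2 * ?q \<le> l"
    using n dividend_less_times_div[of n l] by simp_all
  show "n * x \<le> l"
    using x order_trans[OF mult_le_mono2[of x ?m n] m] by simp
  have "?m + 1 \<le> x + ?q" using x by auto
  then have "n\<^sup>2 * (?m + 1) \<le> n\<^sup>2 * (x + ?q)" by (rule mult_le_mono2)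
  moreover have "n * l \<le> n * (n * ?m + n)" using l by (rule mult_le_mono2)
  ultimately have "n * l \<le> n\<^sup>2 * x + l"
    using q by (simp add: algebra_simps power2_eq_square)
  then show "(n - 1) * l \<le> n\<^sup>2 * x"
    by (simp add: diff_mult_distrib)
qed

definition complete_block :: "nat \<Rightarrow> nat \<Rightarrow> (nat \<times> nat \<Rightarrow> nat) \<Rightarrow> nat mat" where
  "complete_block n l g = mat (Suc n) (Suc n) (\<lambda>(i, j).
     if i < n \<and> j < n then g (i, j)
     else if i < n then l - (\<Sum>j<n. g (i, j))
     else if j < n then l - (\<Sum>i<n. g (i, j))
     else (\<Sum>i<n. \<Sum>j<n. g (i, j)) - (n - 1) * l)"

text \<open>The subtractions defining the completion are exact under these hypotheses.\<close>

lemma complete_block_in: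
  assumes n: "n \<ge> 1"
    and row: "\<And>i. i < n \<Longrightarrow> (\<Sum>j<n. g (i, j)) \<le> l"
    and col: "\<And>j. j < n \<Longrightarrow> (\<Sum>i<n. g (i, j)) \<le> l"
    and tot: "(n - 1) * l \<le> (\<Sum>i<n. \<Sum>j<n. g (i, j))"
  shows "complete_block n l g \<in> intersection_matrices (Suc n) l"
proof -
  let ?T = "\<Sum>i<n. \<Sum>j<n. g (i, j)"
  have corner: "s + (?T - (n - 1) * l) = l" if "s + ?T = n * l" for s
    using that tot n by (simp add: diff_mult_distrib)
  have "(\<Sum>i<n. l - (\<Sum>j<n. g (i, j))) + ?T = (\<Sum>i<n. l)"
    using row by (subst sum.distrib[symmetric], intro sum.cong) auto
  then have last_col: "(\<Sum>i<n. l - (\<Sum>j<n. g (i, j))) + (?T - (n - 1) * l) = l"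
    by (intro corner) simp
  have "(\<Sum>j<n. l - (\<Sum>i<n. g (i, j))) + (\<Sum>j<n. \<Sum>i<n. g (i, j)) = (\<Sum>j<n. l)"
    using col by (subst sum.distrib[symmetric], intro sum.cong) auto
  then have last_row: "(\<Sum>j<n. l - (\<Sum>i<n. g (i, j))) + (?T - (n - 1) * l) = l"
    by (intro corner) (simp add: sum.swap[of "\<lambda>j i. g (i, j)"])
  have "(\<Sum>j<Suc n. complete_block n l g $$ (i, j)) = l" if "i < Suc n" for i
    using that row[of i] last_row by (cases "i = n") (auto simp: complete_block_def)
  moreover have "(\<Sum>i<Suc n. complete_block n l g $$ (i, j)) = l" if "j < Suc n" for j
    using that col[of j] last_col by (cases "j = n") (auto simp: complete_block_def)
  ultimately show ?thesis
    by (simp add: intersection_matrices_def) (simp add: complete_block_def)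
qed

lemma card_intersection_matrices_ge:
  assumes n: "n \<ge> 1"
  shows "(l div n\<^sup>2) ^ n\<^sup>2 \<le> card (intersection_matrices (Suc n) l)"
proof -
  define S where "S = {l div n - l div n\<^sup>2 <.. l div n}"
  let ?D = "{..<n} \<times> {..<n}"
  have "n \<le> n\<^sup>2" using n by (simp add: power2_eq_square)
  then have "l div n\<^sup>2 \<le> l div n" using n by (intro div_le_mono2) auto
  then have cardS: "card S = l div n\<^sup>2" by (simp add: S_def)
  have "inj_on (complete_block n l) (?D \<rightarrow>\<^sub>E S)"
  proof (rule inj_onI)
    fix g h assume g: "g \<in> ?D \<rightarrow>\<^sub>E S" and h: "h \<in> ?D \<rightarrow>\<^sub>E S"
      and eq: "complete_block n l g = complete_block n l h"
    show "g = h"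
    proof (rule PiE_ext[OF g h])
      fix p assume "p \<in> ?D"
      then show "g p = h p"
        using arg_cong[OF eq, of "\<lambda>A. A $$ p"] by (auto simp: complete_block_def)
    qed
  qed
  moreover have "complete_block n l ` (?D \<rightarrow>\<^sub>E S) \<subseteq> intersection_matrices (Suc n) l"
  proof (clarify, rule complete_block_in[OF n])
    fix g assume g: "g \<in> ?D \<rightarrow>\<^sub>E S"
    have S: "n * g (i, j) \<le> l" "(n - 1) * l \<le> n\<^sup>2 * g (i, j)" if "i < n" "j < n" for i j
      using block_value_bounds[OF n, of "g (i, j)" l] that g by (auto simp: S_def PiE_def Pi_def)
    have le: "g (i, j) \<le> l div n" if "i < n" "j < n" for i j
      using S(1)[OF that] n by (simp add: less_eq_div_iff_mult_less_eq mult.commute)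
    have nm: "n * (l div n) \<le> l" by simp
    show "(\<Sum>j<n. g (i, j)) \<le> l" if "i < n" for i
      using sum_bounded_above[of "{..<n}" "\<lambda>j. g (i, j)" "l div n"] le[OF that] order_trans[OF _ nm] by simp
    show "(\<Sum>i<n. g (i, j)) \<le> l" if "j < n" for j
      using sum_bounded_above[of "{..<n}" "\<lambda>i. g (i, j)" "l div n"] le[OF _ that] order_trans[OF _ nm] by simp
    have "n\<^sup>2 * ((n - 1) * l) = (\<Sum>i<n. \<Sum>j<n. (n - 1) * l)"
      by (simp add: power2_eq_square)
    also have "\<dots> \<le> (\<Sum>i<n. \<Sum>j<n. n\<^sup>2 * g (i, j))"
      using S by (intro sum_mono) auto
    also have "\<dots> = n\<^sup>2 * (\<Sum>i<n. \<Sum>j<n. g (i, j))"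
      by (simp add: sum_distrib_left)
    finally show "(n - 1) * l \<le> (\<Sum>i<n. \<Sum>j<n. g (i, j))"
      using n by simp
  qed
  ultimately have "card (?D \<rightarrow>\<^sub>E S) \<le> card (intersection_matrices (Suc n) l)"
    by (intro card_inj_on_le finite_intersection_matrices)
  then show ?thesis
    by (simp add: card_PiE cardS card_cartesian_product power2_eq_square)
qed

section \<open>The probability of a small deviation\<close>

text \<open>With \<open>q = l div n\<^sup>2 \<ge> 1\<close> one has \<open>l + 1 \<le> 2 n\<^sup>2 q\<close>, so the lower count \<open>q\<^bsup>n\<^sup>2\<^esup>\<close> loses only a
  constant factor against \<open>(l + 1)\<^bsup>n\<^sup>2\<^esup>\<close>.\<close>

lemma fixed_entry_ratio:
  assumes n: "n \<ge> 1" and l: "l \<ge> n\<^sup>2" and i: "i < Suc n" and j: "j < Suc n"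
  shows "(l + 1) * card {A \<in> intersection_matrices (Suc n) l. A $$ (i, j) = a}
       \<le> (2 * n\<^sup>2) ^ n\<^sup>2 * card (intersection_matrices (Suc n) l)"
proof -
  have pos: "n\<^sup>2 > 0" using n by simp
  define q where "q = l div n\<^sup>2"
  have "q \<ge> 1" using l pos by (simp add: q_def less_eq_div_iff_mult_less_eq)
  have "l < n\<^sup>2 * (q + 1)"
    using dividend_less_times_div[OF pos, of l] by (simp add: q_def)
  also have "\<dots> \<le> n\<^sup>2 * (2 * q)" using \<open>q \<ge> 1\<close> by (intro mult_le_mono2) simp
  finally have lq: "l + 1 \<le> (2 * n\<^sup>2) * q" by (simp add: algebra_simps)
  have "(l + 1) * card {A \<in> intersection_matrices (Suc n) l. A $$ (i, j) = a}
      \<le> (l + 1) * (l + 1) ^ (n\<^sup>2 - 1)"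
    by (intro mult_le_mono2 card_fixed_entry_le n i j)
  also have "\<dots> = (l + 1) ^ n\<^sup>2"
    using power_eq_if[of "l + 1" "n\<^sup>2"] pos by simp
  also have "\<dots> \<le> ((2 * n\<^sup>2) * q) ^ n\<^sup>2"
    using lq by (intro power_mono) auto
  also have "\<dots> = (2 * n\<^sup>2) ^ n\<^sup>2 * q ^ n\<^sup>2"
    by (rule power_mult_distrib)
  also have "\<dots> \<le> (2 * n\<^sup>2) ^ n\<^sup>2 * card (intersection_matrices (Suc n) l)"
    unfolding q_def by (intro mult_le_mono2 card_intersection_matrices_ge n)
  finally show ?thesis .
qed

lemma nat_near_real:
  fixes c r :: real
  assumes "r \<ge> 0"
  shows "finite {a::nat. \<bar>real a - c\<bar> \<le> r}" and "real (card {a::nat. \<bar>real a - c\<bar> \<le> r}) \<le> 2 * r + 1"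
proof -
  let ?W = "{a::nat. \<bar>real a - c\<bar> \<le> r}"
  have sub: "int ` ?W \<subseteq> {\<lceil>c - r\<rceil>..\<lfloor>c + r\<rfloor>}"
    by (auto simp: le_floor_iff ceiling_le_iff abs_le_iff)
  show "finite ?W"
    using finite_subset[OF sub] by (auto dest: finite_imageD)
  have "card ?W = card (int ` ?W)" by (simp add: card_image)
  also have "\<dots> \<le> card {\<lceil>c - r\<rceil>..\<lfloor>c + r\<rfloor>}" using sub by (intro card_mono) auto
  finally have "real (card ?W) \<le> real (nat (\<lfloor>c + r\<rfloor> - \<lceil>c - r\<rceil> + 1))" by simp
  also have "\<dots> \<le> 2 * r + 1"
  proof (cases "\<lfloor>c + r\<rfloor> - \<lceil>c - r\<rceil> + 1 \<ge> 0")
    case True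
    moreover have "real_of_int \<lfloor>c + r\<rfloor> - real_of_int \<lceil>c - r\<rceil> \<le> 2 * r"
      using diff_mono[OF of_int_floor_le[of "c + r"] le_of_int_ceiling[of "c - r"]] by simp
    ultimately show ?thesis by simp
  qed (use assms in simp)
  finally show "real (card ?W) \<le> 2 * r + 1" .
qed

lemma min_deviation_leD:
  assumes "k > 0" "min_deviation k l A \<le> r"
  obtains i j where "i < k" "j < k" "\<bar>real (A $$ (i, j)) - real l / real k\<bar> \<le> r"
proof -
  let ?M = "(\<lambda>(i, j). \<bar>real (A $$ (i, j)) - real l / real k\<bar>) ` ({..<k} \<times> {..<k})"
  have "Min ?M \<in> ?M" using assms(1) by (intro Min_in) auto
  then show ?thesis using assms(2) that by (auto simp: min_deviation_def)
qed

text \<open>The union bound: \<open>(n + 1)\<^sup>2\<close> positions, at most \<open>2 r + 1\<close> values for each, and probability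
  at most \<open>(2 n\<^sup>2)\<^bsup>n\<^sup>2\<^esup> / (l + 1)\<close> for each position and value.\<close>

lemma prob_min_deviation_le:
  fixes r :: real
  assumes n: "n \<ge> 1" and l: "l \<ge> n\<^sup>2" and r: "r \<ge> 0"
  shows "measure_pmf.prob (random_intersection_matrix (Suc n) l) {X. min_deviation (Suc n) l X \<le> r}
     \<le> real ((Suc n)\<^sup>2 * (2 * n\<^sup>2) ^ n\<^sup>2) * ((2 * r + 1) / (real l + 1))"
proof -
  let ?I = "intersection_matrices (Suc n) l" and ?D = "{..<Suc n} \<times> {..<Suc n}"
  define K where "K = (2 * n\<^sup>2) ^ n\<^sup>2"
  define W where "W = {a::nat. \<bar>real a - real l / real (Suc n)\<bar> \<le> r}"
  note finW = nat_near_real(1)[OF r, of "real l / real (Suc n)", folded W_def]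
  note cardW = nat_near_real(2)[OF r, of "real l / real (Suc n)", folded W_def]
  let ?E = "\<lambda>(p, a). {A \<in> ?I. A $$ p = a}"
  have cardI: "card ?I > 0"
    using finite_intersection_matrices intersection_matrices_nonempty by (simp add: card_gt_0_iff)
  have "?I \<inter> {X. min_deviation (Suc n) l X \<le> r} \<subseteq> (\<Union>x\<in>?D \<times> W. ?E x)"
  proof
    fix A assume A: "A \<in> ?I \<inter> {X. min_deviation (Suc n) l X \<le> r}"
    then obtain i j where "i < Suc n" "j < Suc n" "A $$ (i, j) \<in> W"
      unfolding W_def by (auto elim: min_deviation_leD[rotated])
    then show "A \<in> (\<Union>x\<in>?D \<times> W. ?E x)"
      using A by (intro UN_I[of "((i, j), A $$ (i, j))"]) auto
  qed
  then have "card (?I \<inter> {X. min_deviation (Suc n) l X \<le> r}) \<le> card (\<Union>x\<in>?D \<times> W. ?E x)"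
    using finW finite_intersection_matrices by (intro card_mono finite_UN_I) auto
  also have "\<dots> \<le> (\<Sum>x\<in>?D \<times> W. card (?E x))"
    using finW by (intro card_UN_le) auto
  finally have "(l + 1) * card (?I \<inter> {X. min_deviation (Suc n) l X \<le> r})
      \<le> (l + 1) * (\<Sum>x\<in>?D \<times> W. card (?E x))"
    by (rule mult_le_mono2)
  also have "\<dots> = (\<Sum>x\<in>?D \<times> W. (l + 1) * card (?E x))"
    by (rule sum_distrib_left)
  also have "\<dots> \<le> (\<Sum>x\<in>?D \<times> W. K * card ?I)"
    unfolding K_def using fixed_entry_ratio[OF n l] by (intro sum_mono) auto
  also have "\<dots> = (Suc n)\<^sup>2 * K * card W * card ?I"
    by (simp add: card_cartesian_product power2_eq_square del: mult_Suc mult_Suc_right)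
  finally have "real ((l + 1) * card (?I \<inter> {X. min_deviation (Suc n) l X \<le> r}))
      \<le> real ((Suc n)\<^sup>2 * K * card W * card ?I)"
    by (rule of_nat_mono)
  then have "(real l + 1) * card (?I \<inter> {X. min_deviation (Suc n) l X \<le> r})
      \<le> real ((Suc n)\<^sup>2 * K) * card W * card ?I"
    by (simp only: of_nat_mult of_nat_add of_nat_1)
  also have "\<dots> \<le> real ((Suc n)\<^sup>2 * K) * (2 * r + 1) * card ?I"
    using cardW by (intro mult_right_mono mult_left_mono) auto
  finally have "card (?I \<inter> {X. min_deviation (Suc n) l X \<le> r}) / real (card ?I)
      \<le> real ((Suc n)\<^sup>2 * K) * ((2 * r + 1) / (real l + 1))"
    using cardI by (simp add: field_simps)
  then show ?thesis
    unfolding K_def random_intersection_matrix_def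
    by (subst measure_pmf_of_set[OF intersection_matrices_nonempty finite_intersection_matrices])
qed

theorem theorem1p4:
  fixes k :: nat and f :: "nat \<Rightarrow> real"
  assumes "k \<ge> 2"
    and "f \<in> o(\<lambda>l. real l)"
  shows "(\<lambda>l. measure_pmf.prob (random_intersection_matrix k l) {X. min_deviation k l X > f l})
           \<longlonglongrightarrow> 1"
proof -
  obtain n where k: "k = Suc n" and n: "n \<ge> 1"
    using assms(1) by (cases k) auto
  define C where "C = real ((Suc n)\<^sup>2 * (2 * n\<^sup>2) ^ n\<^sup>2)"
  let ?P = "\<lambda>l. measure_pmf.prob (random_intersection_matrix k l)"
  have "(\<lambda>l. (2 * \<bar>f l\<bar> + 1) / (real l + 1)) \<longlonglongrightarrow> 0"
  proof (rule smalloD_tendsto)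
    have "(\<lambda>l. 1 :: real) \<in> o(\<lambda>l. real l)"
      using lim_1_over_n eventually_gt_at_top[of 0]
      by (intro smalloI_tendsto) (auto elim: eventually_mono)
    then have "(\<lambda>l. 2 * \<bar>f l\<bar> + 1) \<in> o(\<lambda>l. real l)"
      using assms(2) by (intro sum_in_smallo) auto
    also have "(\<lambda>l. real l) \<in> O(\<lambda>l. real l + 1)"
      by (intro bigoI[of _ 1]) auto
    finally show "(\<lambda>l. 2 * \<bar>f l\<bar> + 1) \<in> o(\<lambda>l. real l + 1)" .
  qed
  from tendsto_diff[OF tendsto_const tendsto_mult_right_zero[OF this]]
  have lower: "(\<lambda>l. 1 - C * ((2 * \<bar>f l\<bar> + 1) / (real l + 1))) \<longlonglongrightarrow> 1"
    by (simp only: diff_zero)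
  have "1 - C * ((2 * \<bar>f l\<bar> + 1) / (real l + 1)) \<le> ?P l {X. min_deviation k l X > f l}"
    if "l \<ge> n\<^sup>2" for l
  proof -
    \<comment> \<open>The union bound requires a nonnegative radius, while \<open>f\<close> may take negative values.\<close>
    have "?P l {X. \<not> min_deviation k l X > f l} \<le> ?P l {X. min_deviation k l X \<le> \<bar>f l\<bar>}"
      by (intro measure_pmf.finite_measure_mono) auto
    also have "\<dots> \<le> C * ((2 * \<bar>f l\<bar> + 1) / (real l + 1))"
      unfolding C_def k by (rule prob_min_deviation_le[OF n that]) simp
    finally show ?thesis
      using measure_pmf.prob_compl[of "{X. min_deviation k l X > f l}" "random_intersection_matrix k l"]
      by (simp add: Collect_neg_eq Compl_eq_Diff_UNIV del: not_less)
  qed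
  then have "\<forall>\<^sub>F l in sequentially.
      1 - C * ((2 * \<bar>f l\<bar> + 1) / (real l + 1)) \<le> ?P l {X. min_deviation k l X > f l}"
    by (auto simp: eventually_sequentially)
  then show ?thesis
    by (rule tendsto_sandwich[OF _ _ lower tendsto_const]) simp
qed

end
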